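(* For $i\in\{0,1,2\}$ and $N\ge 0$, let $N_d(i,3;N)$ be the number of partitions of $N$ with designated summands whose pd-rank is congruent to $i$ modulo $3$. Then for every $n\ge0$, $$N_d(0,3;3n+2)=N_d(1,3;3n+2)=N_d(2,3;3n+2).$$
   Context: A partition of $N$ with designated summands is an ordinary partition of $N$ in which, for each part size $t$ that occurs, say $m_t$ times, the copies of $t$ are regarded as ordered (positions $1,\dots,m_t$) and exactly one position $i\in\{1,\dots,m_t\}$ is designated; different positions give different objects. The map $\Phi$: let $\gamma$ be a partition in which no part occurs exactly once, with multiplicity $m_k$ of part $k$. Write uniquely $m_k=s_k+t_k$ with $s_k\in\{0,3\}$ and $t_k\in\{0,2,4,6,\dots\}$. Then $\Phi(\gamma)$ is the partition whose multiplicity $b_j$ of part $j$ is: $b_{6k+1}=b_{6k+5}=0$, $b_{6k+2}=t_{3k+1}/2$, $b_{6k+4}=t_{3k+2}/2$, $b_{6k+3}=s_{2k+1}/3$, $b_{6k+6}=s_{2k+2}/3+t_{3k+3}/2$ (for $k\ge0$). (Equivalently, $t_k$ copies of $k$ become $t_k/2$ copies of $2k$, and $s_k=3$ copies of $k$ become one copy of $3k$.) Its parts are all $\not\equiv\pm1\pmod 6$. The map $\Delta$: given a partition $\lambda$ with designated summands, for each part size $t$ occurring $m_t$ times with designated position $i$: if $i=1$, put all $m_t$ copies of $t$ into $\alpha$; if $i\ge2$, put $i$ copies of $t$ into $\gamma$ and $m_t-i$ copies of $t$ into $\alpha$. Then every part of $\gamma$ occurs at least twice; set $\beta=\Phi(\gamma)$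 and $\Delta(\lambda)=(\alpha,\beta)$. The pd-rank of $\lambda$ is $r_d(\lambda)=l_e(\alpha)-l_e(\beta)$, where $(\alpha,\beta)=\Delta(\lambda)$ and $l_e(\mu)$ is the number of even parts of $\mu$ (counted with multiplicity). *)

theory Defs
  imports "HOL-Library.Multiset" "HOL-Number_Theory.Cong"
begin

definition is_partition :: "nat \<Rightarrow> nat multiset \<Rightarrow> bool" where
  "is_partition N \<mu> \<longleftrightarrow> 0 \<notin># \<mu> \<and> sum_mset \<mu> = N"

text \<open>A partition with designated summands is a pair of a partition and a function giving, for
  every part size that occurs, the designated position (counted from 1) among its copies. The
  function is 0 off the parts, so that equality of pairs is equality of objects.\<close>

type_synonym designated = "nat multiset \<times> (nat \<Rightarrow> nat)"

definition is_designated :: "nat \<Rightarrow> designated \<Rightarrow> bool" where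
  "is_designated N P \<longleftrightarrow> (case P of (\<mu>, d) \<Rightarrow>
     is_partition N \<mu> \<and>
     (\<forall>t. t \<in># \<mu> \<longrightarrow> d t \<in> {1..count \<mu> t}) \<and>
     (\<forall>t. t \<notin># \<mu> \<longrightarrow> d t = 0))"

text \<open>The splitting of a multiplicity other than 1 into a number in \<open>{0, 3}\<close> and an even number;
  the value at multiplicity 1 is irrelevant.\<close>

definition s_mult :: "nat multiset \<Rightarrow> nat \<Rightarrow> nat" where
  "s_mult \<gamma> k = (if odd (count \<gamma> k) then 3 else 0)"

definition t_mult :: "nat multiset \<Rightarrow> nat \<Rightarrow> nat" where
  "t_mult \<gamma> k = count \<gamma> k - s_mult \<gamma> k"

lemma s_mult_t_mult_unique:
  assumes "count \<gamma> k \<noteq> 1"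
  shows "count \<gamma> k = s + t \<and> s \<in> {0, 3} \<and> even t \<longleftrightarrow> s = s_mult \<gamma> k \<and> t = t_mult \<gamma> k"
proof -
  have "count \<gamma> k \<ge> 3" if "odd (count \<gamma> k)"
    using that assms by presburger
  then show ?thesis
    by (auto simp: s_mult_def t_mult_def)
qed

definition Phi_mult :: "nat multiset \<Rightarrow> nat \<Rightarrow> nat" where
  "Phi_mult \<gamma> j =
     (if j = 0 then 0
      else if j mod 6 = 2 then t_mult \<gamma> (3 * (j div 6) + 1) div 2
      else if j mod 6 = 4 then t_mult \<gamma> (3 * (j div 6) + 2) div 2
      else if j mod 6 = 3 then s_mult \<gamma> (2 * (j div 6) + 1) div 3
      else if j mod 6 = 0 then
        \<comment> \<open>Here \<open>j = 6 * k + 6\<close> with \<open>k = j div 6 - 1\<close>.\<close>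
        s_mult \<gamma> (2 * (j div 6 - 1) + 2) div 3 + t_mult \<gamma> (3 * (j div 6 - 1) + 3) div 2
      else 0)"

definition Phi :: "nat multiset \<Rightarrow> nat multiset" where
  "Phi \<gamma> = Abs_multiset (Phi_mult \<gamma>)"

lemma count_Phi: "count (Phi \<gamma>) j = Phi_mult \<gamma> j"
proof -
  have s0: "k \<in># \<gamma>" if "s_mult \<gamma> k > 0" for k
    using that by (cases "k \<in># \<gamma>") (simp_all add: s_mult_def not_in_iff)
  have t0: "k \<in># \<gamma>" if "t_mult \<gamma> k > 0" for k
    using that by (cases "k \<in># \<gamma>") (simp_all add: t_mult_def not_in_iff)
  have "{j. Phi_mult \<gamma> j > 0} \<subseteq> (\<lambda>k. 2 * k) ` set_mset \<gamma> \<union> (\<lambda>k. 3 * k) ` set_mset \<gamma>"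
  proof
    fix j assume "j \<in> {j. Phi_mult \<gamma> j > 0}"
    then have j: "Phi_mult \<gamma> j > 0" by simp
    consider "j mod 6 = 2" | "j mod 6 = 4" | "j mod 6 = 3" | "j mod 6 = 0" "j \<noteq> 0"
      using j by (auto simp: Phi_mult_def split: if_splits)
    then have "(\<exists>k. j = 2 * k \<and> t_mult \<gamma> k > 0) \<or> (\<exists>k. j = 3 * k \<and> s_mult \<gamma> k > 0)"
    proof cases
      case 1
      define q where "q = j div 6"
      have "j = 6 * q + 2"
        using 1 mult_div_mod_eq[of 6 j] unfolding q_def by simp
      then have "j = 2 * (3 * q + 1)" by simp
      moreover have "t_mult \<gamma> (3 * q + 1) > 0"
        using j 1 by (cases "t_mult \<gamma> (3 * q + 1)") (simp_all add: Phi_mult_def q_def split: if_splits)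
      ultimately show ?thesis by blast
    next
      case 2
      define q where "q = j div 6"
      have "j = 6 * q + 4"
        using 2 mult_div_mod_eq[of 6 j] unfolding q_def by simp
      then have "j = 2 * (3 * q + 2)" by simp
      moreover have "t_mult \<gamma> (3 * q + 2) > 0"
        using j 2 by (cases "t_mult \<gamma> (3 * q + 2)") (simp_all add: Phi_mult_def q_def split: if_splits)
      ultimately show ?thesis by blast
    next
      case 3
      define q where "q = j div 6"
      have "j = 6 * q + 3"
        using 3 mult_div_mod_eq[of 6 j] unfolding q_def by simp
      then have "j = 3 * (2 * q + 1)" by simp
      moreover have "s_mult \<gamma> (2 * q + 1) > 0"
        using j 3 by (cases "s_mult \<gamma> (2 * q + 1)") (simp_all add: Phi_mult_def q_def split: if_splits)
      ultimately show ?thesis by blast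
    next
      case 4
      define q where "q = j div 6 - 1"
      have "j = 6 * (j div 6)" "j div 6 > 0"
        using 4 mult_div_mod_eq[of 6 j] by (simp_all add: dvd_imp_le mod_eq_0_iff_dvd div_greater_zero_iff)
      then have "j = 6 * q + 6"
        unfolding q_def by simp
      then have "j = 3 * (2 * q + 2)" "j = 2 * (3 * q + 3)" by simp_all
      moreover have "s_mult \<gamma> (2 * q + 2) div 3 + t_mult \<gamma> (3 * q + 3) div 2 > 0"
        using j 4 by (simp add: Phi_mult_def q_def)
      then have "s_mult \<gamma> (2 * q + 2) > 0 \<or> t_mult \<gamma> (3 * q + 3) > 0"
        by (cases "s_mult \<gamma> (2 * q + 2)"; cases "t_mult \<gamma> (3 * q + 3)") simp_all
      ultimately show ?thesis by blast
    qed
    then show "j \<in> (\<lambda>k. 2 * k) ` set_mset \<gamma> \<union> (\<lambda>k. 3 * k) ` set_mset \<gamma>"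
      using s0 t0 by blast
  qed
  then have "finite {j. Phi_mult \<gamma> j > 0}"
    by (rule finite_subset) simp
  then show ?thesis
    by (simp add: Phi_def Abs_multiset_inverse)
qed

lemma count_Phi_residues:
  "count (Phi \<gamma>) (6 * k + 1) = 0"
  "count (Phi \<gamma>) (6 * k + 5) = 0"
  "count (Phi \<gamma>) (6 * k + 2) = t_mult \<gamma> (3 * k + 1) div 2"
  "count (Phi \<gamma>) (6 * k + 4) = t_mult \<gamma> (3 * k + 2) div 2"
  "count (Phi \<gamma>) (6 * k + 3) = s_mult \<gamma> (2 * k + 1) div 3"
  "count (Phi \<gamma>) (6 * k + 6) = s_mult \<gamma> (2 * k + 2) div 3 + t_mult \<gamma> (3 * k + 3) div 2"
proof -
  have r: "(6 * k + r) mod 6 = r" "(6 * k + r) div 6 = k" if "r < 6" for r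
    using that by auto
  show "count (Phi \<gamma>) (6 * k + 1) = 0"
    using r[of 1] by (simp only: count_Phi Phi_mult_def) simp
  show "count (Phi \<gamma>) (6 * k + 5) = 0"
    using r[of 5] by (simp only: count_Phi Phi_mult_def) simp
  show "count (Phi \<gamma>) (6 * k + 2) = t_mult \<gamma> (3 * k + 1) div 2"
    using r[of 2] by (simp only: count_Phi Phi_mult_def) simp
  show "count (Phi \<gamma>) (6 * k + 4) = t_mult \<gamma> (3 * k + 2) div 2"
    using r[of 4] by (simp only: count_Phi Phi_mult_def) simp
  show "count (Phi \<gamma>) (6 * k + 3) = s_mult \<gamma> (2 * k + 1) div 3"
    using r[of 3] by (simp only: count_Phi Phi_mult_def) simp
  have "(6 * k + 6) mod 6 = 0" "(6 * k + 6) div 6 - 1 = k" by simp_all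
  then show "count (Phi \<gamma>) (6 * k + 6) = s_mult \<gamma> (2 * k + 2) div 3 + t_mult \<gamma> (3 * k + 3) div 2"
    unfolding count_Phi Phi_mult_def by simp
qed

definition Delta_alpha :: "designated \<Rightarrow> nat multiset" where
  "Delta_alpha P = (case P of (\<mu>, d) \<Rightarrow>
     \<Sum>t\<in>set_mset \<mu>. replicate_mset (if d t = 1 then count \<mu> t else count \<mu> t - d t) t)"

definition Delta_gamma :: "designated \<Rightarrow> nat multiset" where
  "Delta_gamma P = (case P of (\<mu>, d) \<Rightarrow>
     \<Sum>t\<in>set_mset \<mu>. replicate_mset (if d t = 1 then 0 else d t) t)"

definition Delta :: "designated \<Rightarrow> nat multiset \<times> nat multiset" where
  "Delta P = (Delta_alpha P, Phi (Delta_gamma P))"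

definition num_even_parts :: "nat multiset \<Rightarrow> nat" where
  "num_even_parts \<mu> = size (filter_mset even \<mu>)"

definition pd_rank :: "designated \<Rightarrow> int" where
  "pd_rank P = (case Delta P of (\<alpha>, \<beta>) \<Rightarrow> int (num_even_parts \<alpha>) - int (num_even_parts \<beta>))"

definition N_d :: "int \<Rightarrow> int \<Rightarrow> nat \<Rightarrow> nat" where
  "N_d i m N = card {P. is_designated N P \<and> [pd_rank P = i] (mod m)}"

lemma finite_designated: "finite {P. is_designated N P}"
proof -
  define F where "F = {f :: nat \<Rightarrow> nat. \<forall>x. (x \<in> {..N} \<longrightarrow> f x \<in> {..N}) \<and> (x \<notin> {..N} \<longrightarrow> f x = 0)}"
  have fin: "finite F"
    unfolding F_def by (rule finite_set_of_finite_funs) auto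
  have mult: "count \<mu> t * t \<le> N" if "is_partition N \<mu>" for \<mu> t
  proof -
    have "replicate_mset (count \<mu> t) t \<subseteq># \<mu>"
      by (simp add: count_le_replicate_mset_subset_eq[symmetric])
    then have "sum_mset (replicate_mset (count \<mu> t) t) \<le> sum_mset \<mu>"
      by (metis le_add1 subset_mset.le_iff_add sum_mset.union)
    then show ?thesis using that by (simp add: is_partition_def)
  qed
  have cF: "count \<mu> \<in> F" if p: "is_partition N \<mu>" for \<mu>
  proof -
    have "count \<mu> t \<le> N \<and> (N < t \<longrightarrow> count \<mu> t = 0)" for t
    proof (cases "count \<mu> t = 0")
      case False
      then have "t > 0" using p by (cases t) (auto simp: is_partition_def not_in_iff)
      have "count \<mu> t * 1 \<le> count \<mu> t * t" "1 * t \<le> count \<mu> t * t"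
        using \<open>t > 0\<close> False by (intro mult_le_mono; simp)+
      then show ?thesis using mult[OF p, of t] by linarith
    qed simp
    then show ?thesis by (auto simp: F_def)
  qed
  have dF: "d \<in> F" if "is_designated N (\<mu>, d)" for \<mu> d
  proof -
    have c: "count \<mu> \<in> F" using that cF by (simp add: is_designated_def)
    have "d t \<le> count \<mu> t" for t
      using that by (cases "t \<in># \<mu>") (auto simp: is_designated_def)
    then show ?thesis using c unfolding F_def
      by (simp add: not_le) (metis le_trans le_zero_eq)
  qed
  have "map_prod count id ` {P. is_designated N P} \<subseteq> F \<times> F"
    using cF dF by (auto simp: is_designated_def)
  then have "finite (map_prod count id ` {P. is_designated N P})"
    by (rule finite_subset) (simp add: fin)
  moreover have "inj_on (map_prod count id) {P. is_designated N P}"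
    by (auto simp: inj_on_def count_inject)
  ultimately show ?thesis
    by (rule finite_imageD)
qed

end

theory Submission
  imports Defs "HOL-Computational_Algebra.Formal_Power_Series"
begin

text \<open>Splitting off \<open>\<alpha>\<close> and \<open>\<gamma>\<close> shows that a partition with designated summands is the same as a choice,
  for every part size \<open>t\<close>, of a number of copies of \<open>t\<close> in \<open>\<alpha>\<close>, a number of pairs \<open>t, t\<close> in \<open>\<gamma>\<close>, and
  at most one triple \<open>t, t, t\<close> in \<open>\<gamma>\<close>. Hence, for a primitive cube root of unity \<open>w\<close>, the generating
  function of \<open>w\<close> to the power of the pd-rank is the product of
  \<open>1 / (1 - w\<^bsup>[t even]\<^esup> q\<^bsup>t\<^esup>)\<close>, \<open>1 / (1 - w\<^bsup>-1\<^esup> q\<^bsup>2t\<^esup>)\<close> and \<open>1 + w\<^bsup>-[t even]\<^esup> q\<^bsup>3t\<^esup>\<close> over all \<open>t\<close>. Since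
  \<open>(1 - w y) (1 - w\<^bsup>-1\<^esup> y) = (1 - y\<^sup>3) / (1 - y)\<close>, it is a power series in \<open>q\<^sup>3\<close> times Gauss's product of
  \<open>(1 - q\<^bsup>2k\<^esup>) / (1 - q\<^bsup>2k-1\<^esup>)\<close>, which equals the sum of \<open>q\<^bsup>s(s+1)/2\<^esup>\<close>. No triangular number is
  congruent to 2 modulo 3, so the coefficient of \<open>q\<^bsup>3n+2\<^esup>\<close> vanishes, and \<open>c\<^sub>0 + c\<^sub>1 w + c\<^sub>2 w\<^sup>2 = 0\<close> with
  integers \<open>c\<^sub>i\<close> forces \<open>c\<^sub>0 = c\<^sub>1 = c\<^sub>2\<close>. All products are truncated at a bound large enough not to
  affect the coefficient in question.\<close>

unbundle fps_syntax

section \<open>Gauss's product for the triangular numbers\<close>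

definition theta_ratio :: "nat \<Rightarrow> 'a::field fps" where
  "theta_ratio k = (1 - fps_X ^ (2 * k)) * inverse (1 - fps_X ^ (2 * k - 1))"

lemma one_minus_X_power_inverse:
  fixes c :: "'a::field"
  assumes "e > 0"
  shows "(1 - fps_const c * fps_X ^ e) * inverse (1 - fps_const c * fps_X ^ e) = 1"
proof -
  have "(1 - fps_const c * fps_X ^ e) $ 0 = 1"
    using assms by simp
  then show ?thesis
    by (metis inverse_mult_eq_1' zero_neq_one)
qed

lemma theta_ratio_mult:
  assumes "k > 0"
  shows "theta_ratio k * (1 - fps_X ^ (2 * k - 1)) = (1 - fps_X ^ (2 * k) :: 'a::field fps)"
  using one_minus_X_power_inverse[of "2 * k - 1" "1::'a"] assms
  by (simp add: theta_ratio_def mult_ac)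

definition theta_tail :: "nat \<Rightarrow> nat \<Rightarrow> 'a::field fps" where
  "theta_tail s n = (\<Prod>k\<in>{s<..n}. theta_ratio k)"

lemma theta_tail_same: "theta_tail n n = 1"
  by (simp add: theta_tail_def)

lemma theta_tail_Suc: "s \<le> n \<Longrightarrow> theta_tail s (Suc n) = theta_tail s n * theta_ratio (Suc n)"
proof -
  assume "s \<le> n"
  then have "{s<..Suc n} = insert (Suc n) {s<..n}" by auto
  then show ?thesis by (simp add: theta_tail_def mult_ac)
qed

lemma theta_tail_step: "s < n \<Longrightarrow> theta_tail s n = theta_ratio (Suc s) * theta_tail (Suc s) n"
proof -
  assume "s < n"
  then have "{s<..n} = insert (Suc s) {Suc s<..n}" by auto
  then show ?thesis by (simp add: theta_tail_def)
qed

text \<open>Gauss's identity in the finite form of D. Shanks (1951): every summand but the one for \<open>s = 0\<close>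
  on the left-hand side of \<open>shanks_identity\<close> is divisible by \<open>q\<^bsup>2n+1\<^esup>\<close>.\<close>

lemma shanks_telescope:
  fixes n :: nat
  defines "Y \<equiv> (fps_X :: 'a::field fps) ^ (2 * n + 1)"
  assumes "m \<le> n"
  shows "(\<Sum>s<m. theta_tail s (Suc n) * fps_X ^ (s * (2 * n + 3)) - theta_tail s n * Y ^ s) * (1 - Y)
       = theta_tail m n * (1 - fps_X ^ (2 * m)) * Y ^ m"
  using assms(2)
proof (induction m)
  case (Suc m)
  let ?X = "fps_X :: 'a fps"
  have t: "theta_tail m (Suc n) * (1 - Y) = theta_tail m n * (1 - ?X ^ (2 * n + 2))"
    using theta_ratio_mult[of "Suc n", where ?'a='a] Suc.prems
    by (simp add: theta_tail_Suc Y_def mult.assoc)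
  have X1: "?X ^ (m * (2 * n + 3)) = Y ^ m * ?X ^ (2 * m)"
  proof -
    have "m * (2 * n + 3) = (2 * n + 1) * m + 2 * m"
      by (simp add: algebra_simps)
    then show ?thesis
      by (simp only: Y_def power_add power_mult)
  qed
  have X2: "?X ^ (2 * n + 2) = Y * ?X"
    by (simp add: Y_def)
  have r: "theta_tail m n * (1 - ?X ^ (2 * m + 1)) = theta_tail (Suc m) n * (1 - ?X ^ (2 * Suc m))"
    using theta_ratio_mult[of "Suc m", where ?'a='a] Suc.prems
    by (simp add: theta_tail_step[of m n] mult_ac)
  \<comment> \<open>Times \<open>1 - Y\<close>, the summand for \<open>s = m\<close> is a difference
    of two consecutive values of the right-hand side; \<open>r\<close> brings the first of them into
    the form for \<open>Suc m\<close>.\<close>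
  have "(theta_tail m (Suc n) * ?X ^ (m * (2 * n + 3)) - theta_tail m n * Y ^ m) * (1 - Y)
      = (theta_tail m (Suc n) * (1 - Y)) * (Y ^ m * ?X ^ (2 * m)) - theta_tail m n * Y ^ m * (1 - Y)"
    unfolding X1 by (simp add: algebra_simps)
  also have "\<dots> = theta_tail m n * (1 - ?X ^ (2 * m + 1)) * Y ^ Suc m
                 - theta_tail m n * (1 - ?X ^ (2 * m)) * Y ^ m"
    unfolding t X2 by (simp add: algebra_simps)
  finally show ?case
    using Suc unfolding r by (simp add: distrib_right)
qed simp

text \<open>Induction on \<open>n\<close>: with \<open>Y = q^(2n+1)\<close>, passing to
  \<open>Suc n\<close> adds \<open>Y^n + Y^(n+1)\<close> on the left, and these are the powers for
  the two new triangular numbers, \<open>s = 2n\<close> and \<open>s = 2n+1\<close>.\<close>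

lemma shanks_identity:
  "(\<Sum>s<n. theta_tail s n * fps_X ^ (s * (2 * n + 1))) =
   (\<Sum>s<2 * n. fps_X ^ (s * (s + 1) div 2) :: 'a::field fps)"
proof (induction n)
  case (Suc n)
  let ?X = "fps_X :: 'a fps"
  define Y where "Y = ?X ^ (2 * n + 1)"
  define T where "T = (\<Sum>s<n. theta_tail s (Suc n) * ?X ^ (s * (2 * n + 3)))"
  define S where "S = (\<Sum>s<n. theta_tail s n * Y ^ s)"
  have TS: "(T - S) * (1 - Y) = (1 - ?X ^ (2 * n)) * Y ^ n"
    using shanks_telescope[of n n, where ?'a='a]
    by (simp add: T_def S_def Y_def sum_subtractf theta_tail_same)
  have r: "theta_ratio (Suc n) * (1 - Y) = 1 - Y * ?X"
    using theta_ratio_mult[of "Suc n", where ?'a='a] by (simp add: Y_def mult.commute)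
  have Xn: "?X ^ (n * (2 * n + 3)) = Y ^ n * ?X ^ (2 * n)"
  proof -
    have "n * (2 * n + 3) = (2 * n + 1) * n + 2 * n"
      by (simp add: algebra_simps)
    then show ?thesis
      by (simp only: Y_def power_add power_mult)
  qed
  \<comment> \<open>The new summand \<open>s = n\<close> completes the telescoped difference to
    \<open>Y^n (1 - Y^2)\<close>, from which \<open>1 - Y\<close> can be cancelled.\<close>
  have "(T - S + theta_ratio (Suc n) * ?X ^ (n * (2 * n + 3))) * (1 - Y)
      = (T - S) * (1 - Y) + (theta_ratio (Suc n) * (1 - Y)) * (Y ^ n * ?X ^ (2 * n))"
    unfolding Xn by (simp add: algebra_simps)
  also have "\<dots> = Y ^ n * (1 - Y * (?X ^ (2 * n) * ?X))"
    unfolding TS r by (simp add: algebra_simps)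
  also have "?X ^ (2 * n) * ?X = Y"
    by (simp add: Y_def mult.commute)
  also have "Y ^ n * (1 - Y * Y) = (Y ^ n + Y ^ Suc n) * (1 - Y)"
    by (simp add: algebra_simps)
  finally have eq: "(T - S + theta_ratio (Suc n) * ?X ^ (n * (2 * n + 3))) * (1 - Y)
      = (Y ^ n + Y ^ Suc n) * (1 - Y)" .
  have "(1 - Y) $ 0 \<noteq> 0" by (simp add: Y_def)
  then have "1 - Y \<noteq> 0" by (metis fps_zero_nth)
  with eq have step: "T + theta_ratio (Suc n) * ?X ^ (n * (2 * n + 3)) = S + Y ^ n + Y ^ Suc n"
    by (simp only: mult_cancel_right) (simp add: algebra_simps)
  have S: "S = (\<Sum>s<2 * n. ?X ^ (s * (s + 1) div 2))"
    unfolding Suc.IH[symmetric] S_def Y_def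
    by (simp only: power_mult[symmetric] mult.commute[of "2 * n + 1"])
  have "2 * n * (2 * n + 1) div 2 = (2 * n + 1) * n"
    by simp
  then have Y1: "Y ^ n = ?X ^ (2 * n * (2 * n + 1) div 2)"
    by (simp only: Y_def power_mult)
  have "(2 * n + 1) * (2 * n + 1 + 1) = 2 * ((2 * n + 1) * Suc n)"
    by (simp add: algebra_simps)
  then have "(2 * n + 1) * (2 * n + 1 + 1) div 2 = (2 * n + 1) * Suc n"
    by simp
  then have Y2: "Y ^ Suc n = ?X ^ ((2 * n + 1) * (2 * n + 1 + 1) div 2)"
    by (simp only: Y_def power_mult)
  have "(\<Sum>s<Suc n. theta_tail s (Suc n) * ?X ^ (s * (2 * Suc n + 1)))
      = T + theta_ratio (Suc n) * ?X ^ (n * (2 * n + 3))"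
    by (simp add: T_def theta_tail_Suc theta_tail_same algebra_simps)
  also have "\<dots> = (\<Sum>s<Suc (Suc (2 * n)). ?X ^ (s * (s + 1) div 2))"
    unfolding step S Y1 Y2 sum.lessThan_Suc by (simp only: Suc_eq_plus1)
  finally show ?case
    by simp
qed simp

text \<open>If a triangular number were 2 modulo 3, its double \<open>s (s + 1)\<close> would be 1
  modulo 3, but that product is always 0 or 2.\<close>

lemma triangular_mod_3: "(s * (s + 1) div 2) mod 3 \<noteq> (2::nat)"
proof -
  define q where "q = s div 3"
  have "s * (s + 1) = 3 * (q * (3 * q + 1)) \<or> s * (s + 1) = 3 * (q * (3 * q + 3)) + 2
      \<or> s * (s + 1) = 3 * ((3 * q + 2) * (q + 1))"
  proof -
    have "s = 3 * q \<or> s = 3 * q + 1 \<or> s = 3 * q + 2"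
      unfolding q_def by presburger
    then show ?thesis
      by (elim disjE) (simp_all add: algebra_simps)
  qed
  then have "(s * (s + 1)) mod 3 \<noteq> 1"
    by presburger
  moreover have "even (s * (s + 1))"
    by simp
  ultimately show ?thesis
    by presburger
qed

section \<open>Power series supported on residue classes modulo 3, up to a degree bound\<close>

definition supp_mod3 :: "nat \<Rightarrow> nat set \<Rightarrow> 'a::zero fps \<Rightarrow> bool" where
  "supp_mod3 N R f \<longleftrightarrow> (\<forall>m\<le>N. f $ m \<noteq> 0 \<longrightarrow> m mod 3 \<in> R)"

text \<open>A coefficient of degree at most \<open>N\<close> involves only such coefficients of the
  factors, and adding an exponent divisible by 3 keeps the residue.\<close>

lemma supp_mod3_mult:
  fixes f g :: "'a::comm_ring_1 fps"
  assumes "supp_mod3 N R f" "supp_mod3 N {0} g"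
  shows "supp_mod3 N R (f * g)"
  unfolding supp_mod3_def
proof (intro allI impI)
  fix m assume m: "m \<le> N" "(f * g) $ m \<noteq> 0"
  then obtain i where i: "i \<le> m" "f $ i * g $ (m - i) \<noteq> 0"
    by (auto simp: fps_mult_nth elim: sum.not_neutral_contains_not_neutral)
  then have "f $ i \<noteq> 0" "g $ (m - i) \<noteq> 0" by auto
  then have "i mod 3 \<in> R" "(m - i) mod 3 = 0"
    using assms m i unfolding supp_mod3_def by auto
  moreover have "m mod 3 = i mod 3" if "(m - i) mod 3 = 0"
    using that i(1) by presburger
  ultimately show "m mod 3 \<in> R"
    by simp
qed

lemma supp_mod3_prod:
  fixes f :: "'b \<Rightarrow> 'a::comm_ring_1 fps"
  assumes "\<And>i. i \<in> I \<Longrightarrow> supp_mod3 N {0} (f i)"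
  shows "supp_mod3 N {0} (\<Prod>i\<in>I. f i)"
  using assms
proof (induction I rule: infinite_finite_induct)
  case (insert i I)
  then show ?case by (simp add: supp_mod3_mult)
qed (simp_all add: supp_mod3_def)

lemma supp_mod3_theta:
  "supp_mod3 (2 * n) {0, 1} (\<Prod>k=1..n. theta_ratio k :: 'a::field fps)"
  unfolding supp_mod3_def
proof (intro allI impI)
  fix m assume m: "m \<le> 2 * n" "(\<Prod>k=1..n. theta_ratio k :: 'a fps) $ m \<noteq> 0"
  let ?X = "fps_X :: 'a fps"
  have "\<exists>s. m = s * (s + 1) div 2"
  \<comment> \<open>For \<open>n = 0\<close> both sums in \<open>shanks_identity\<close> are empty
    although the product is 1, so this case is treated apart.\<close>
  proof (cases "n = 0")
    case False
    have "(\<Sum>s<n. theta_tail s n * ?X ^ (s * (2 * n + 1))) $ m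
        = (\<Sum>s<n. if s = 0 then theta_tail s n $ m else 0)"
      unfolding fps_sum_nth
    proof (intro sum.cong refl)
      fix s assume "s \<in> {..<n}"
      \<comment> \<open>Summands with \<open>s > 0\<close> start at degree \<open>2n + 1\<close> or
        later, so in this range only \<open>theta_tail 0 n\<close>, the product itself, is
        visible.\<close>
      have "s > 0 \<Longrightarrow> m < s * (2 * n + 1)"
        using m(1) by (cases s) auto
      then show "(theta_tail s n * ?X ^ (s * (2 * n + 1))) $ m = (if s = 0 then theta_tail s n $ m else 0)"
        by (simp add: fps_X_power_mult_right_nth)
    qed
    also have "\<dots> = theta_tail 0 n $ m"
      using False by simp
    also have "\<dots> \<noteq> 0"
      using m(2) by (simp add: theta_tail_def atLeastSucAtMost_greaterThanAtMost)
    finally have "(\<Sum>s<2 * n. ?X ^ (s * (s + 1) div 2)) $ m \<noteq> 0"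
      by (simp only: shanks_identity not_False_eq_True)
    then obtain s where "(?X ^ (s * (s + 1) div 2)) $ m \<noteq> 0"
      by (auto simp: fps_sum_nth elim: sum.not_neutral_contains_not_neutral)
    then show ?thesis
      by (auto simp: fps_X_power_nth split: if_splits)
  next
    case True
    then have "m = 0 * (0 + 1) div 2" using m by simp
    then show ?thesis by blast
  qed
  then have "m mod 3 \<noteq> 2"
    using triangular_mod_3 by blast
  then have "m mod 3 = 0 \<or> m mod 3 = 1"
    by linarith
  then show "m mod 3 \<in> {0, 1}"
    by blast
qed

section \<open>The generating function at a cube root of unity\<close>

definition geo :: "'a::field \<Rightarrow> nat \<Rightarrow> 'a fps" where
  "geo c e = inverse (1 - fps_const c * fps_X ^ e)"

lemma geo_mult_cancel:
  assumes "e > 0"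
  shows "(1 - fps_const c * fps_X ^ e) * geo c e = 1"
  using one_minus_X_power_inverse[OF assms] by (simp add: geo_def)

lemma geo_eqI:
  fixes c :: "'a::field"
  assumes "e > 0" "(1 - fps_const c * fps_X ^ e) * f = g"
  shows "f = g * geo c e"
proof -
  have "g * geo c e = ((1 - fps_const c * fps_X ^ e) * geo c e) * f"
    unfolding assms(2)[symmetric] by (simp only: mult_ac)
  also have "(1 - fps_const c * fps_X ^ e) * geo c e = 1"
    by (rule geo_mult_cancel[OF assms(1)])
  finally show ?thesis by simp
qed

lemma geo_nth:
  assumes "e > 0"
  shows "geo c e $ m = (if e dvd m then c ^ (m div e) else 0)"
proof -
  define f where "f = Abs_fps (\<lambda>m. if e dvd m then c ^ (m div e) else 0)"
  have "(1 - fps_const c * fps_X ^ e) * f = 1"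
  proof (rule fps_ext)
    fix m
    have "((1 - fps_const c * fps_X ^ e) * f) $ m = f $ m - c * (fps_X ^ e * f) $ m"
      by (simp add: left_diff_distrib mult.assoc)
    also have "\<dots> = (1 :: 'a fps) $ m"
    proof (cases "m < e")
      case True
      then show ?thesis using assms
        by (auto simp: f_def fps_X_power_mult_nth dest: dvd_imp_le)
    next
      case False
      then obtain j where "m = e + j" using le_Suc_ex not_less by blast
      then show ?thesis using assms
        by (simp add: f_def fps_X_power_mult_nth)
    qed
    finally show "((1 - fps_const c * fps_X ^ e) * f) $ m = (1 :: 'a fps) $ m" .
  qed
  then have "geo c e = f"
    using geo_eqI[OF assms, of c f 1] by simp
  then show ?thesis
    by (simp add: f_def)
qed

lemma prod_pairs:
  fixes h :: "nat \<Rightarrow> 'a::comm_monoid_mult"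
  shows "(\<Prod>t=1..2 * n. h t) = (\<Prod>k=1..n. h (2 * k - 1) * h (2 * k))"
  by (induction n) (simp_all add: mult_ac)

text \<open>Here \<open>w\<^sup>2\<close> plays the role of \<open>w\<^bsup>-1\<^esup>\<close>.\<close>

definition rank_series :: "'a::field \<Rightarrow> nat \<Rightarrow> 'a fps" where
  "rank_series w M = (\<Prod>t=1..M. geo (if even t then w else 1) t * geo (w\<^sup>2) (2 * t) *
     (1 + fps_const (if even t then w\<^sup>2 else 1) * fps_X ^ (3 * t)))"

text \<open>The roots of unity 1, \<open>w\<close>, \<open>w\<^sup>2\<close> give
  \<open>1 - Y^3 = (1 - Y) (1 - w Y) (1 - w^2 Y)\<close>; divide by the last two factors and by
  \<open>1 - Y^3\<close>.\<close>

lemma geo_cube_root: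
  fixes w :: "'a::field"
  assumes w: "w\<^sup>2 + w + 1 = 0" and "e > 0"
  shows "geo w e * geo (w\<^sup>2) e = (1 - fps_X ^ e) * geo 1 (3 * e)"
proof -
  define Y where "Y = (fps_X :: 'a fps) ^ e"
  define W where "W = fps_const w"
  have W2: "fps_const (w\<^sup>2) = W\<^sup>2"
    by (simp add: W_def power2_eq_square)
  \<comment> \<open>The relation for \<open>w\<close> is lifted to constant series, so that the
    factorisation is an identity within one ring.\<close>
  have "W\<^sup>2 + W + 1 = fps_const (w\<^sup>2 + w + 1)"
    unfolding W2[symmetric] W_def by (simp flip: fps_const_add fps_const_1_eq_1)
  then have W: "W\<^sup>2 + W + 1 = 0" by (simp add: w)
  have Y3: "fps_X ^ (3 * e) = Y ^ 3"
    by (simp add: Y_def mult.commute flip: power_mult)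
  have fac: "1 - Y ^ 3 = (1 - Y) * ((1 - W * Y) * (1 - W\<^sup>2 * Y))"
    using W by algebra
  have g: "(1 - W * Y) * geo w e = 1" "(1 - W\<^sup>2 * Y) * geo (w\<^sup>2) e = 1"
    using geo_mult_cancel[OF assms(2), of w] geo_mult_cancel[OF assms(2), of "w\<^sup>2"]
    by (simp_all add: W2 Y_def W_def[symmetric])
  have "(1 - fps_const 1 * fps_X ^ (3 * e)) * (geo w e * geo (w\<^sup>2) e) = (1 - Y ^ 3) * (geo w e * geo (w\<^sup>2) e)"
    by (simp add: Y3)
  also have "\<dots> = (1 - Y) * ((1 - W * Y) * geo w e) * ((1 - W\<^sup>2 * Y) * geo (w\<^sup>2) e)"
    unfolding fac by (simp only: mult_ac)
  also have "\<dots> = 1 - fps_X ^ e"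
    unfolding g by (simp add: Y_def)
  finally show ?thesis
    using assms(2) by (intro geo_eqI) simp_all
qed

text \<open>Either all exponents are multiples of 3, or only the constant term lies within the
  bound.\<close>

lemma supp_mod3_geo:
  assumes "e > 0" "3 dvd e \<or> N < e"
  shows "supp_mod3 N {0} (geo c e)"
  using assms unfolding supp_mod3_def
  by (auto simp: geo_nth dest: dvd_imp_le split: if_splits intro: dvd_trans)

text \<open>The factor for an even part size \<open>2k\<close> in \<alpha> is paired with the one
  for pairs of \<open>k\<close> in \<gamma>. By \<open>geo_cube_root\<close> this yields the
  numerator of \<open>theta_ratio k\<close> and a series in \<open>q^(6k)\<close>; the odd sizes
  supply the denominators.\<close>

lemma supp_mod3_rank_series:
  fixes w :: "'a::field"
  assumes w: "w\<^sup>2 + w + 1 = 0"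
  shows "supp_mod3 (2 * n) {0, 1} (rank_series w (2 * n))"
proof -
  let ?X = "fps_X :: 'a fps"
  define C where "C = (\<Prod>t=1..2 * n. 1 + fps_const (if even t then w\<^sup>2 else 1) * ?X ^ (3 * t))"
  have "(\<Prod>t=1..2 * n. geo (if even t then w else 1) t) = (\<Prod>k=1..n. geo 1 (2 * k - 1) * geo w (2 * k))"
    unfolding prod_pairs by (intro prod.cong) auto
  \<comment> \<open>The factors with \<open>k > n\<close> have no partner, but their exponents
    \<open>2k\<close> exceed the degree bound.\<close>
  moreover have "(\<Prod>t=1..2 * n. geo (w\<^sup>2) (2 * t)) =
      (\<Prod>k=1..n. geo (w\<^sup>2) (2 * k)) * (\<Prod>k=n+1..n+n. geo (w\<^sup>2) (2 * k))"
    by (subst prod.ub_add_nat[symmetric]) (simp_all add: mult_2)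
  ultimately have "rank_series w (2 * n) =
      (\<Prod>k=1..n. geo 1 (2 * k - 1) * (geo w (2 * k) * geo (w\<^sup>2) (2 * k))) *
      (\<Prod>k=n+1..n+n. geo (w\<^sup>2) (2 * k)) * C"
    by (simp add: rank_series_def C_def prod.distrib mult_ac)
  also have "(\<Prod>k=1..n. geo 1 (2 * k - 1) * (geo w (2 * k) * geo (w\<^sup>2) (2 * k)))
      = (\<Prod>k=1..n. theta_ratio k * geo 1 (3 * (2 * k)))"
    by (intro prod.cong refl) (simp add: geo_cube_root[OF w] theta_ratio_def, simp add: geo_def mult_ac)
  also have "\<dots> = (\<Prod>k=1..n. theta_ratio k) * (\<Prod>k=1..n. geo 1 (3 * (2 * k)))"
    by (rule prod.distrib)
  finally have eq: "rank_series w (2 * n) = (\<Prod>k=1..n. theta_ratio k) *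
      (\<Prod>k=1..n. geo 1 (3 * (2 * k))) * (\<Prod>k=n+1..n+n. geo (w\<^sup>2) (2 * k)) * C" .
  have "supp_mod3 (2 * n) {0} C"
    unfolding C_def by (rule supp_mod3_prod) (auto simp: supp_mod3_def fps_X_power_nth split: if_splits)
  moreover have "supp_mod3 (2 * n) {0} (\<Prod>k=1..n. geo (1::'a) (3 * (2 * k)))"
    by (rule supp_mod3_prod, rule supp_mod3_geo) auto
  moreover have "supp_mod3 (2 * n) {0} (\<Prod>k=n+1..n+n. geo (w\<^sup>2) (2 * k))"
    by (rule supp_mod3_prod, rule supp_mod3_geo) auto
  ultimately show ?thesis
    unfolding eq by (intro supp_mod3_mult supp_mod3_theta)
qed

text \<open>Expanding the product amounts to choosing one state per index. Finiteness is carried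
  through the induction because rearranging the sums requires it.\<close>

lemma fps_prod_nth_states:
  fixes F :: "'i \<Rightarrow> 'a::comm_ring_1 fps" and size :: "'i \<Rightarrow> 's \<Rightarrow> nat"
  assumes "finite I"
    and fin: "\<And>i k. i \<in> I \<Longrightarrow> finite {s\<in>S i. size i s = k}"
    and nth: "\<And>i k. i \<in> I \<Longrightarrow> F i $ k = (\<Sum>s | s \<in> S i \<and> size i s = k. wt i s)"
  shows "finite {f\<in>Pi\<^sub>E I S. (\<Sum>i\<in>I. size i (f i)) = n} \<and>
    (\<Prod>i\<in>I. F i) $ n = (\<Sum>f | f \<in> Pi\<^sub>E I S \<and> (\<Sum>i\<in>I. size i (f i)) = n. \<Prod>i\<in>I. wt i (f i))"
  using assms
proof (induction I arbitrary: n rule: finite_induct)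
  case empty
  have "{f. f \<in> Pi\<^sub>E {} S \<and> (\<Sum>i\<in>{}. size i (f i)) = n} = (if n = 0 then {\<lambda>_. undefined} else {})"
    by auto
  then show ?case by simp
next
  case (insert i I)
  define A where "A k = {s\<in>S i. size i s = k}" for k
  define B where "B k = {f\<in>Pi\<^sub>E I S. (\<Sum>j\<in>I. size j (f j)) = k}" for k
  \<comment> \<open>The index \<open>k\<close> of the Cauchy product is the size of the state at
    \<open>i\<close>; \<phi> forgets it and glues that state to a choice on
    \<open>I\<close>.\<close>
  define D where "D = (SIGMA k:{0..n}. A k \<times> B (n - k))"
  define \<phi> where "\<phi> = (\<lambda>(k::nat, s, f). f(i := s) :: 'i \<Rightarrow> 's)"
  have IH: "finite (B k)" "(\<Prod>j\<in>I. F j) $ k = (\<Sum>f\<in>B k. \<Prod>j\<in>I. wt j (f j))" for k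
    using insert.IH[of k] insert.prems by (auto simp: B_def)
  have finA: "finite (A k)" for k
    using insert.prems(1)[of i] by (simp add: A_def)
  have upd: "(\<Sum>j\<in>I. size j ((f(i := s)) j)) = (\<Sum>j\<in>I. size j (f j))"
    "(\<Prod>j\<in>I. wt j ((f(i := s)) j)) = (\<Prod>j\<in>I. wt j (f j))" for f s
    using insert.hyps by (intro sum.cong prod.cong; force)+
  have inj: "inj_on \<phi> D"
  proof (rule inj_onI)
    fix x x' assume x: "x \<in> D" "x' \<in> D" and eq: "\<phi> x = \<phi> x'"
    obtain k s f k' s' f' where xs: "x = (k, s, f)" "x' = (k', s', f')"
      by (cases x, cases x')
    have f: "f \<in> Pi\<^sub>E I S" "f' \<in> Pi\<^sub>E I S" and k: "k = size i s" "k' = size i s'"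
      using x by (auto simp: xs D_def A_def B_def)
    have upd_eq: "f(i := s) = f'(i := s')"
      using eq by (simp add: xs \<phi>_def)
    have "s = s'"
      using fun_cong[OF upd_eq, of i] by simp
    moreover have "f = f'"
    proof
      \<comment> \<open>At \<open>i\<close> itself the update hides the old values, but both
        functions are \<open>undefined\<close> there, since \<open>i\<close> lies outside
        \<open>I\<close>.\<close>
      fix y show "f y = f' y"
      proof (cases "y = i")
        case True
        then show ?thesis
          using PiE_arb[OF f(1) insert.hyps(2)] PiE_arb[OF f(2) insert.hyps(2)] by simp
      next
        case False
        then show ?thesis using fun_cong[OF upd_eq, of y] by simp
      qed
    qed
    ultimately show "x = x'" by (simp add: xs k)
  qed
  have img: "\<phi> ` D = {f\<in>Pi\<^sub>E (insert i I) S. (\<Sum>j\<in>insert i I. size j (f j)) = n}"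
  proof (intro equalityI subsetI)
    fix g assume "g \<in> \<phi> ` D"
    then obtain k s f where g: "g = f(i := s)" "k \<le> n" "s \<in> S i" "size i s = k"
      "f \<in> Pi\<^sub>E I S" "(\<Sum>j\<in>I. size j (f j)) = n - k"
      by (auto simp: D_def \<phi>_def A_def B_def)
    have "g \<in> Pi\<^sub>E (insert i I) S"
      unfolding g(1) using g(3,5) by (intro PiE_fun_upd)
    moreover have "(\<Sum>j\<in>insert i I. size j (g j)) = n"
      using insert.hyps g(2,4,6) upd(1)[of f s] by (simp add: g(1) del: fun_upd_apply) simp
    ultimately show "g \<in> {f\<in>Pi\<^sub>E (insert i I) S. (\<Sum>j\<in>insert i I. size j (f j)) = n}"
      by simp
  next
    fix g assume g: "g \<in> {f\<in>Pi\<^sub>E (insert i I) S. (\<Sum>j\<in>insert i I. size j (f j)) = n}"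
    then have "g(i := undefined) \<in> Pi\<^sub>E I S" "g i \<in> S i"
      using insert.hyps by (auto intro: fun_upd_in_PiE)
    moreover have "(\<Sum>j\<in>I. size j ((g(i := undefined)) j)) = n - size i (g i)" "size i (g i) \<le> n"
      using g insert.hyps unfolding upd(1) by auto
    ultimately have "(size i (g i), g i, g(i := undefined)) \<in> D"
      unfolding D_def A_def B_def by simp
    then show "g \<in> \<phi> ` D"
      by (rule rev_image_eqI) (simp add: \<phi>_def)
  qed
  have finD: "finite D" by (auto simp: D_def finA IH)
  have "(\<Prod>j\<in>insert i I. F j) $ n = (\<Sum>k=0..n. F i $ k * (\<Prod>j\<in>I. F j) $ (n - k))"
    using insert.hyps by (simp add: fps_mult_nth)
  also have "\<dots> = (\<Sum>k=0..n. \<Sum>s\<in>A k. \<Sum>f\<in>B (n - k). wt i s * (\<Prod>j\<in>I. wt j (f j)))"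
    using insert.prems(2)[of i] by (simp add: IH A_def sum_product)
  also have "\<dots> = (\<Sum>(k, s, f)\<in>D. wt i s * (\<Prod>j\<in>I. wt j (f j)))"
    unfolding D_def by (simp add: sum.Sigma sum.cartesian_product finA IH)
  also have "\<dots> = (\<Sum>x\<in>D. \<Prod>j\<in>insert i I. wt j (\<phi> x j))"
  proof (intro sum.cong refl)
    fix x assume "x \<in> D"
    obtain k s f where x: "x = (k, s, f)" by (cases x)
    show "(case x of (k, s, f) \<Rightarrow> wt i s * (\<Prod>j\<in>I. wt j (f j))) = (\<Prod>j\<in>insert i I. wt j (\<phi> x j))"
      unfolding x \<phi>_def prod.case prod.insert[OF insert.hyps] upd(2) by simp
  qed
  also have "\<dots> = (\<Sum>f\<in>\<phi> ` D. \<Prod>j\<in>insert i I. wt j (f j))"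
    by (simp add: sum.reindex[OF inj])
  finally show ?case
    using finite_imageI[OF finD, of \<phi>] unfolding img by simp
qed

section \<open>Partitions with designated summands as configurations\<close>

definition alpha_mult :: "designated \<Rightarrow> nat \<Rightarrow> nat" where
  "alpha_mult P t = (if snd P t = 1 then count (fst P) t else count (fst P) t - snd P t)"

definition gamma_mult :: "designated \<Rightarrow> nat \<Rightarrow> nat" where
  "gamma_mult P t = (if snd P t = 1 then 0 else snd P t)"

lemma count_sum_replicate:
  assumes "finite A"
  shows "count (\<Sum>t\<in>A. replicate_mset (g t) t) x = (if x \<in> A then g x else 0)"
  using assms by (simp add: count_sum sum.delta' cong: if_cong)

lemma count_Delta_alpha:
  assumes "is_designated N P"
  shows "count (Delta_alpha P) t = alpha_mult P t"
proof (cases P)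
  case (Pair \<mu> d)
  then show ?thesis
    using assms by (auto simp: Delta_alpha_def alpha_mult_def count_sum_replicate is_designated_def not_in_iff)
qed

lemma count_Delta_gamma:
  assumes "is_designated N P"
  shows "count (Delta_gamma P) t = gamma_mult P t"
proof (cases P)
  case (Pair \<mu> d)
  then show ?thesis
    using assms by (auto simp: Delta_gamma_def gamma_mult_def count_sum_replicate is_designated_def not_in_iff)
qed

text \<open>The table of residues modulo 6 says uniformly that a pair of copies of \<open>k\<close>
  becomes one \<open>2k\<close> and a triple becomes one \<open>3k\<close>.\<close>

lemma count_Phi_eq:
  assumes "j > 0"
  shows "count (Phi \<gamma>) j = (if 2 dvd j then t_mult \<gamma> (j div 2) div 2 else 0)
                            + (if 3 dvd j then s_mult \<gamma> (j div 3) div 3 else 0)"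
proof -
  define q where "q = j div 6"
  have "j = 6 * q + j mod 6" "j mod 6 < 6" by (simp_all add: q_def)
  then consider "j = 6 * q" | "j = 6 * q + 1" | "j = 6 * q + 2" | "j = 6 * q + 3"
    | "j = 6 * q + 4" | "j = 6 * q + 5"
    by linarith
  then show ?thesis
  proof cases
    case 1
    \<comment> \<open>The table lists this class as \<open>6k + 6\<close>, hence the shift by
      one.\<close>
    then obtain k where "q = Suc k" using assms by (cases q) auto
    then have "j = 6 * k + 6" using 1 by simp
    moreover from this have "j div 2 = 3 * k + 3" "j div 3 = 2 * k + 2" "2 dvd j" "3 dvd j"
      by presburger+
    ultimately show ?thesis using count_Phi_residues(6)[of \<gamma> k] by simp
  next
    case 2
    then have "\<not> 2 dvd j" "\<not> 3 dvd j" by presburger+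
    then show ?thesis using 2 count_Phi_residues(1)[of \<gamma> q] by simp
  next
    case 3
    then have "j div 2 = 3 * q + 1" "2 dvd j" "\<not> 3 dvd j" by presburger+
    then show ?thesis using 3 count_Phi_residues(3)[of \<gamma> q] by simp
  next
    case 4
    then have "j div 3 = 2 * q + 1" "\<not> 2 dvd j" "3 dvd j" by presburger+
    then show ?thesis using 4 count_Phi_residues(5)[of \<gamma> q] by simp
  next
    case 5
    then have "j div 2 = 3 * q + 2" "2 dvd j" "\<not> 3 dvd j" by presburger+
    then show ?thesis using 5 count_Phi_residues(4)[of \<gamma> q] by simp
  next
    case 6
    then have "\<not> 2 dvd j" "\<not> 3 dvd j" by presburger+
    then show ?thesis using 6 count_Phi_residues(2)[of \<gamma> q] by simp
  qed
qed

section \<open>Even parts and the pd-rank modulo 3\<close>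

lemma num_even_parts_eq_sum:
  assumes "finite A" "set_mset \<mu> \<subseteq> A"
  shows "num_even_parts \<mu> = (\<Sum>t\<in>A. if even t then count \<mu> t else 0)"
proof -
  have "num_even_parts \<mu> = (\<Sum>t\<in>set_mset (filter_mset even \<mu>). count (filter_mset even \<mu>) t)"
    by (simp add: num_even_parts_def size_multiset_overloaded_eq)
  also have "\<dots> = (\<Sum>t\<in>A. count (filter_mset even \<mu>) t)"
    using assms by (intro sum.mono_neutral_left) (auto simp: not_in_iff)
  also have "\<dots> = (\<Sum>t\<in>A. if even t then count \<mu> t else 0)"
    by (intro sum.cong) auto
  finally show ?thesis .
qed

lemma filter_mset_replicate_mset:
  "filter_mset Q (replicate_mset k x) = (if Q x then replicate_mset k x else {#})"
  by (induction k) auto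

text \<open>The parts \<open>2t\<close> arising from pairs are always even, the parts
  \<open>3t\<close> arising from triples only for even \<open>t\<close>.\<close>

lemma num_even_parts_Phi:
  assumes "set_mset \<gamma> \<subseteq> {1..M}"
  shows "num_even_parts (Phi \<gamma>) = (\<Sum>t=1..M. t_mult \<gamma> t div 2 + (if even t then s_mult \<gamma> t div 3 else 0))"
proof -
  have z: "t_mult \<gamma> t = 0" "s_mult \<gamma> t = 0" if "t \<notin> {1..M}" for t
  proof -
    have "count \<gamma> t = 0" using assms that by (meson not_in_iff subsetD)
    then show "t_mult \<gamma> t = 0" "s_mult \<gamma> t = 0" by (simp_all add: t_mult_def s_mult_def)
  qed
  have "Phi \<gamma> = (\<Sum>t=1..M. replicate_mset (t_mult \<gamma> t div 2) (2 * t)) + (\<Sum>t=1..M. replicate_mset (s_mult \<gamma> t div 3) (3 * t))"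
  proof (rule multiset_eqI)
    fix j
    \<comment> \<open>Only \<open>t = j / m\<close> can contribute; if it falls outside the range,
      \<open>g\<close> vanishes there.\<close>
    have c: "(\<Sum>t=1..M. count (replicate_mset (g t) (m * t)) j) = (if m dvd j then g (j div m) else 0)"
      if g: "\<And>t. t \<notin> {1..M} \<Longrightarrow> g t = 0" and "m > 0" for g :: "nat \<Rightarrow> nat" and m
    proof (cases "m dvd j")
      case True
      then obtain k where j: "j = m * k" by blast
      have "(\<Sum>t=1..M. count (replicate_mset (g t) (m * t)) j) = (\<Sum>t=1..M. if t = k then g k else 0)"
        using \<open>m > 0\<close> by (intro sum.cong) (auto simp: j)
      then show ?thesis using g[of k] \<open>m > 0\<close> by (simp add: j)
    next
      case False
      then show ?thesis by (auto intro!: sum.neutral)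
    qed
    show "count (Phi \<gamma>) j = count ((\<Sum>t=1..M. replicate_mset (t_mult \<gamma> t div 2) (2 * t)) + (\<Sum>t=1..M. replicate_mset (s_mult \<gamma> t div 3) (3 * t))) j"
    proof (cases "j = 0")
      case True
      then show ?thesis by (simp add: count_Phi Phi_mult_def count_sum)
    next
      case False
      then show ?thesis
        using c[of "\<lambda>t. t_mult \<gamma> t div 2" 2] c[of "\<lambda>t. s_mult \<gamma> t div 3" 3] z
        by (simp only: count_Phi_eq[of j] plus_multiset.rep_eq count_sum) simp
    qed
  qed
  moreover have "num_even_parts (A + B) = num_even_parts A + num_even_parts B" for A B
    by (simp add: num_even_parts_def)
  moreover have "num_even_parts (\<Sum>t=1..M. replicate_mset (g t) (m * t)) = (\<Sum>t=1..M. if even (m * t) then g t else 0)" for g m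
    by (induction M) (auto simp: num_even_parts_def filter_mset_replicate_mset)
  ultimately show ?thesis
    by (simp add: sum.distrib)
qed

text \<open>The factor 2 stands for \<open>-1\<close> modulo 3, which keeps the exponents of \<open>w\<close> natural numbers.\<close>

definition even_weight :: "designated \<Rightarrow> nat" where
  "even_weight P = num_even_parts (Delta_alpha P) + 2 * num_even_parts (Phi (Delta_gamma P))"

lemma pd_rank_cong:
  "[pd_rank P = int i] (mod 3) \<longleftrightarrow> even_weight P mod 3 = i mod 3"
proof -
  have "[pd_rank P = int (even_weight P)] (mod 3)"
    by (simp add: pd_rank_def Delta_def even_weight_def cong_iff_dvd_diff)
  then have "[pd_rank P = int i] (mod 3) \<longleftrightarrow> [int (even_weight P) = int i] (mod 3)"
    using cong_sym cong_trans by blast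
  also have "\<dots> \<longleftrightarrow> even_weight P mod 3 = i mod 3"
    using cong_int_iff[of "even_weight P" i 3] by (simp add: cong_def)
  finally show ?thesis .
qed

lemma sum_mset_eq_sum_count:
  fixes \<mu> :: "nat multiset"
  assumes "finite A" "set_mset \<mu> \<subseteq> A"
  shows "sum_mset \<mu> = (\<Sum>t\<in>A. t * count \<mu> t)"
  using assms(2)
proof (induction \<mu>)
  case (add x \<mu>)
  have "(\<Sum>t\<in>A. t * count (add_mset x \<mu>) t) = (\<Sum>t\<in>A. t * count \<mu> t + (if t = x then x else 0))"
    by (intro sum.cong) auto
  also have "\<dots> = sum_mset \<mu> + x"
    using add assms(1) by (simp add: sum.distrib)
  finally show ?case by simp
qed simp

lemma set_mset_partition:
  assumes "is_partition N \<mu>" "N \<le> M"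
  shows "set_mset \<mu> \<subseteq> {1..M}"
proof
  fix t assume t: "t \<in># \<mu>"
  then have "t \<le> sum_mset \<mu>"
    by (metis le_add1 multi_member_split sum_mset.add_mset)
  moreover have "t \<noteq> 0"
    using t assms(1) unfolding is_partition_def by metis
  ultimately show "t \<in> {1..M}"
    using assms by (auto simp: is_partition_def)
qed

lemma designated_position_le:
  assumes "is_designated N P"
  shows "snd P t \<le> count (fst P) t" "snd P t = 0 \<longleftrightarrow> count (fst P) t = 0"
  using assms
  by (cases P; cases "t \<in># fst P"; force simp: is_designated_def not_in_iff)+

text \<open>In a configuration \<open>f\<close>, the values \<open>f (t, 0)\<close>, \<open>f (t, 1)\<close> and \<open>f (t, 2)\<close> are the number of copies
  of \<open>t\<close> in \<open>\<alpha>\<close>, half of the even part of its multiplicity in \<open>\<gamma>\<close>, and a third of the remainder.\<close>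

abbreviation components :: "nat \<Rightarrow> (nat \<times> nat) set" where
  "components M \<equiv> {1..M} \<times> {0, 1, 2}"

definition states :: "nat \<times> nat \<Rightarrow> nat set" where
  "states i = (if snd i = 2 then {0, 1} else UNIV)"

text \<open>Coordinate \<open>c\<close> counts blocks of \<open>c + 1\<close> equal parts: single
  copies, pairs, triples.\<close>

definition state_size :: "nat \<times> nat \<Rightarrow> nat \<Rightarrow> nat" where
  "state_size i x = (snd i + 1) * fst i * x"

text \<open>Even parts of \<alpha> weigh 1 and even parts of \<beta> weigh 2, as in
  \<open>even_weight\<close>. The exception for \<open>snd i = 1\<close> is due to pairs of
  \<open>t\<close> becoming \<open>2t\<close>, even for every \<open>t\<close>.\<close>

definition state_weight :: "nat \<times> nat \<Rightarrow> nat \<Rightarrow> nat" where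
  "state_weight i x = (if even (fst i) \<or> snd i = 1 then (if snd i = 0 then 1 else 2) * x else 0)"

definition encode :: "nat \<Rightarrow> designated \<Rightarrow> nat \<times> nat \<Rightarrow> nat" where
  "encode M P = restrict (\<lambda>(t, c). if c = 0 then alpha_mult P t
     else if c = 1 then t_mult (Delta_gamma P) t div 2 else s_mult (Delta_gamma P) t div 3) (components M)"

text \<open>A positive multiplicity in \<gamma> is the designated position and is never 1. Without
  copies in \<gamma> the position is 1 if \<open>t\<close> occurs and 0 otherwise.\<close>

definition decode :: "nat \<Rightarrow> (nat \<times> nat \<Rightarrow> nat) \<Rightarrow> designated" where
  "decode M f =
    ((\<Sum>t=1..M. replicate_mset (f (t, 0) + 2 * f (t, 1) + 3 * f (t, 2)) t),
     (\<lambda>t. if t \<in> {1..M} then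
            if 2 * f (t, 1) + 3 * f (t, 2) = 0 then (if f (t, 0) = 0 then 0 else 1)
            else 2 * f (t, 1) + 3 * f (t, 2)
          else 0))"

definition configurations :: "nat \<Rightarrow> nat \<Rightarrow> (nat \<times> nat \<Rightarrow> nat) set" where
  "configurations M N = {f \<in> Pi\<^sub>E (components M) states. (\<Sum>i\<in>components M. state_size i (f i)) = N}"

lemma sum_components:
  "(\<Sum>i\<in>components M. g i) = (\<Sum>t=1..M. g (t, 0) + g (t, 1) + g (t, 2) :: 'a::comm_monoid_add)"
  using sum.cartesian_product[of "\<lambda>t c. g (t, c)" "{0, 1, 2}" "{1..M}"]
  by (simp add: add.assoc)

lemma prod_components:
  "(\<Prod>i\<in>components M. g i) = (\<Prod>t=1..M. g (t, 0) * g (t, 1) * g (t, 2) :: 'a::comm_monoid_mult)"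
  using prod.cartesian_product[of "\<lambda>t c. g (t, c)" "{0, 1, 2}" "{1..M}"]
  by (simp add: mult.assoc)

lemma encode_apply:
  assumes "is_designated N P" "t \<in> {1..M}"
  shows "encode M P (t, 0) = alpha_mult P t"
    "encode M P (t, 1) = (gamma_mult P t - (if odd (gamma_mult P t) then 3 else 0)) div 2"
    "encode M P (t, 2) = (if odd (gamma_mult P t) then 1 else 0)"
  using assms by (auto simp: encode_def t_mult_def s_mult_def count_Delta_gamma)

lemma alpha_gamma_mult:
  assumes "is_designated N P"
  shows "count (fst P) t = alpha_mult P t + gamma_mult P t" "gamma_mult P t \<noteq> 1"
  using designated_position_le[OF assms, of t] by (auto simp: alpha_mult_def gamma_mult_def)

lemma encode_gamma:
  assumes "is_designated N P" "t \<in> {1..M}"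
  shows "2 * encode M P (t, 1) + 3 * encode M P (t, 2) = gamma_mult P t"
proof -
  \<comment> \<open>An odd multiplicity other than 1 is at least 3, so the subtraction in
    \<open>encode_apply\<close> is not cut off at 0.\<close>
  have "gamma_mult P t \<ge> 3" if "odd (gamma_mult P t)"
    using alpha_gamma_mult(2)[OF assms(1), of t] that by presburger
  then show ?thesis
    unfolding encode_apply[OF assms] by auto
qed

lemma encode_in_configurations:
  assumes "is_designated N P" "N \<le> M"
  shows "encode M P \<in> configurations M N"
proof -
  have part: "is_partition N (fst P)"
    using assms by (cases P) (simp add: is_designated_def)
  have "encode M P \<in> Pi\<^sub>E (components M) states"
    by (auto simp: encode_def states_def s_mult_def)
  moreover have "(\<Sum>i\<in>components M. state_size i (encode M P i)) = (\<Sum>t=1..M. t * count (fst P) t)"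
    unfolding sum_components
  proof (intro sum.cong refl)
    fix t assume t: "t \<in> {1..M}"
    show "state_size (t, 0) (encode M P (t, 0)) + state_size (t, 1) (encode M P (t, 1))
        + state_size (t, 2) (encode M P (t, 2)) = t * count (fst P) t"
      unfolding alpha_gamma_mult(1)[OF assms(1)] encode_gamma[OF assms(1) t, symmetric] encode_apply(1)[OF assms(1) t]
      by (simp add: state_size_def algebra_simps)
  qed
  moreover have "\<dots> = N"
    using sum_mset_eq_sum_count[OF _ set_mset_partition[OF part assms(2)]] part
    by (simp add: is_partition_def)
  ultimately show ?thesis
    by (simp add: configurations_def)
qed

lemma count_decode:
  "count (fst (decode M f)) t = (if t \<in> {1..M} then f (t, 0) + 2 * f (t, 1) + 3 * f (t, 2) else 0)"
  by (simp only: decode_def fst_conv count_sum_replicate[OF finite_atLeastAtMost])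

lemma decode_encode:
  assumes "is_designated N P" "N \<le> M"
  shows "decode M (encode M P) = P"
proof (rule prod_eqI)
  have part: "is_partition N (fst P)"
    using assms by (cases P) (simp add: is_designated_def)
  have out: "count (fst P) t = 0" if "t \<notin> {1..M}" for t
    using set_mset_partition[OF part assms(2)] that by (meson not_in_iff subsetD)
  show "fst (decode M (encode M P)) = fst P"
  proof (rule multiset_eqI)
    fix t
    show "count (fst (decode M (encode M P))) t = count (fst P) t"
      using out alpha_gamma_mult(1)[OF assms(1), of t] encode_gamma[OF assms(1), of t M]
        encode_apply(1)[OF assms(1), of t M]
      unfolding count_decode by (auto simp del: atLeastAtMost_iff)
  qed
  show "snd (decode M (encode M P)) = snd P"
  proof
    fix t
    show "snd (decode M (encode M P)) t = snd P t"
    proof (cases "t \<in> {1..M}")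
      case True
      then show ?thesis
        using designated_position_le[OF assms(1), of t]
        unfolding decode_def snd_conv encode_gamma[OF assms(1) True] encode_apply(1)[OF assms(1) True]
        by (auto simp: alpha_mult_def gamma_mult_def)
    next
      case False
      then show ?thesis
        using designated_position_le(2)[OF assms(1), of t] out[OF False]
        by (auto simp: decode_def)
    qed
  qed
qed

lemma decode_designated:
  assumes "f \<in> configurations M N"
  shows "is_designated N (decode M f)"
proof -
  let ?\<mu> = "fst (decode M f)" and ?d = "snd (decode M f)"
  have sub: "set_mset ?\<mu> \<subseteq> {1..M}"
    using count_decode[of M f] by (metis not_in_iff subsetI)
  have "sum_mset ?\<mu> = (\<Sum>t=1..M. t * count ?\<mu> t)"
    by (rule sum_mset_eq_sum_count[OF _ sub]) simp
  also have "\<dots> = (\<Sum>i\<in>components M. state_size i (f i))"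
    unfolding sum_components by (intro sum.cong) (auto simp: count_decode state_size_def algebra_simps)
  also have "\<dots> = N"
    using assms by (simp add: configurations_def)
  finally have "is_partition N ?\<mu>"
    using sub by (auto simp: is_partition_def)
  moreover have "?d t \<in> {1..count ?\<mu> t}" if "t \<in># ?\<mu>" for t
  proof -
    have t: "t \<in> {1..M}" using sub that by blast
    have "count ?\<mu> t \<noteq> 0" using that by simp
    then show ?thesis
      using t unfolding count_decode by (auto simp: decode_def)
  qed
  moreover have "?d t = 0" if "t \<notin># ?\<mu>" for t
  proof -
    have "count ?\<mu> t = 0" using that by (simp add: not_in_iff)
    then show ?thesis
      unfolding count_decode by (auto simp: decode_def split: if_splits)
  qed
  ultimately show ?thesis
    unfolding is_designated_def by (simp add: case_prod_unfold)
qed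

lemma encode_decode:
  assumes "f \<in> configurations M N"
  shows "encode M (decode M f) = f"
proof
  have f: "f \<in> Pi\<^sub>E (components M) states"
    using assms by (simp add: configurations_def)
  have des: "is_designated N (decode M f)"
    by (rule decode_designated[OF assms])
  fix i
  show "encode M (decode M f) i = f i"
  proof (cases "i \<in> components M")
    case True
    then obtain t c where i: "i = (t, c)" and t: "t \<in> {1..M}" and c: "c = 0 \<or> c = 1 \<or> c = 2"
      by auto
    \<comment> \<open>With at most one triple, the parity of the multiplicity in \<gamma> determines
      \<open>f (t, 2)\<close>, and then \<open>f (t, 1)\<close>.\<close>
    have s: "f (t, 2) = 0 \<or> f (t, 2) = 1"
      using PiE_mem[OF f, of "(t, 2)"] t by (auto simp: states_def)
    have g: "gamma_mult (decode M f) t = 2 * f (t, 1) + 3 * f (t, 2)"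
      using t s by (auto simp: gamma_mult_def decode_def)
    have a: "alpha_mult (decode M f) t = f (t, 0)"
      using alpha_gamma_mult(1)[OF des, of t] t unfolding count_decode g by simp
    show ?thesis
      using c s unfolding i
      by (elim disjE) (simp_all only: encode_apply[OF des t] a g, simp_all)
  next
    case False
    then show ?thesis
      using PiE_arb[OF f False] by (simp add: encode_def)
  qed
qed

lemma even_weight_eq_sum:
  assumes "is_designated N P" "N \<le> M"
  shows "even_weight P = (\<Sum>i\<in>components M. state_weight i (encode M P i))"
proof -
  have part: "is_partition N (fst P)"
    using assms by (cases P) (simp add: is_designated_def)
  have sub: "set_mset (fst P) \<subseteq> {1..M}"
    by (rule set_mset_partition[OF part assms(2)])
  have "t \<in># fst P" if "t \<in># Delta_alpha P \<or> t \<in># Delta_gamma P" for t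
    using that alpha_gamma_mult(1)[OF assms(1), of t]
    by (auto simp: count_Delta_alpha[OF assms(1)] count_Delta_gamma[OF assms(1)] simp flip: count_greater_zero_iff)
  then have "set_mset (Delta_alpha P) \<subseteq> {1..M}" "set_mset (Delta_gamma P) \<subseteq> {1..M}"
    using sub by blast+
  then have "even_weight P = (\<Sum>t=1..M. (if even t then count (Delta_alpha P) t else 0)
      + 2 * (t_mult (Delta_gamma P) t div 2 + (if even t then s_mult (Delta_gamma P) t div 3 else 0)))"
    using num_even_parts_eq_sum[of "{1..M}" "Delta_alpha P"]
    by (simp add: even_weight_def num_even_parts_Phi sum.distrib sum_distrib_left)
  also have "\<dots> = (\<Sum>i\<in>components M. state_weight i (encode M P i))"
    unfolding sum_components
    by (intro sum.cong refl) (auto simp: state_weight_def encode_def count_Delta_alpha[OF assms(1)])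
  finally show ?thesis .
qed

section \<open>Coefficients of the generating function and the equidistribution\<close>

definition factor :: "'a::field \<Rightarrow> nat \<times> nat \<Rightarrow> 'a fps" where
  "factor w = (\<lambda>(t, c). if c = 0 then geo (if even t then w else 1) t
     else if c = 1 then geo (w\<^sup>2) (2 * t)
     else 1 + fps_const (if even t then w\<^sup>2 else 1) * fps_X ^ (3 * t))"

lemma factor_nth:
  assumes i: "i \<in> components M"
  shows "finite {x \<in> states i. state_size i x = k}"
    and "factor w i $ k = (\<Sum>x | x \<in> states i \<and> state_size i x = k. w ^ state_weight i x)"
proof -
  obtain t c where tc: "i = (t, c)" "t > 0" "c = 0 \<or> c = 1 \<or> c = 2"
    using i by auto
  define e where "e = (c + 1) * t"
  have e: "e > 0" using tc by (simp add: e_def)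
  have size: "state_size i x = e * x" for x
    by (simp add: state_size_def tc e_def)
  \<comment> \<open>Since \<open>e > 0\<close>, at most one state has a given size, so each
    coefficient is zero or a single power of \<open>w\<close>.\<close>
  have set: "{x \<in> states i. state_size i x = k} = (if e dvd k \<and> k div e \<in> states i then {k div e} else {})"
    using e unfolding size by auto
  then show "finite {x \<in> states i. state_size i x = k}"
    by simp
  have "factor w i $ k = (if e dvd k \<and> k div e \<in> states i then w ^ state_weight i (k div e) else 0)"
    using tc(3)
  proof (elim disjE)
    assume "c = 2"
    moreover have "e dvd k \<and> k div e \<in> {0, 1} \<longleftrightarrow> k = 0 \<or> k = e"
      using e by (auto elim!: dvdE)
    ultimately show ?thesis
      using e by (auto simp: factor_def tc(1) e_def states_def state_weight_def fps_X_power_nth)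
  qed (use e in \<open>auto simp: factor_def tc(1) e_def geo_nth states_def state_weight_def simp flip: power_mult mult_2\<close>)
  then show "factor w i $ k = (\<Sum>x | x \<in> states i \<and> state_size i x = k. w ^ state_weight i x)"
    unfolding set by simp
qed

text \<open>Parts of a partition of \<open>N\<close> are at most \<open>N\<close>, so truncating at
  \<open>M\<close> loses nothing; \<open>encode\<close> and \<open>decode\<close> carry the sum over
  configurations to designated partitions.\<close>

lemma rank_series_nth:
  fixes w :: "'a::field"
  assumes "N \<le> M"
  shows "rank_series w M $ N = (\<Sum>P | is_designated N P. w ^ even_weight P)"
proof -
  have "rank_series w M = (\<Prod>i\<in>components M. factor w i)"
    unfolding prod_components by (simp add: rank_series_def factor_def)
  also have "\<dots> $ N = (\<Sum>f\<in>configurations M N. \<Prod>i\<in>components M. w ^ state_weight i (f i))"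
    unfolding configurations_def
    by (rule fps_prod_nth_states[THEN conjunct2]) (simp_all only: finite_cartesian_product finite_atLeastAtMost
      finite.insertI finite.emptyI factor_nth)
  also have "\<dots> = (\<Sum>P | is_designated N P. w ^ even_weight P)"
    by (rule sum.reindex_bij_witness[where i = "encode M" and j = "decode M"])
      (use assms in \<open>simp_all add: encode_decode decode_designated decode_encode encode_in_configurations
         even_weight_eq_sum[OF decode_designated assms] power_sum\<close>)
  finally show ?thesis .
qed

theorem theorem3p4:
  fixes n :: nat
  shows "N_d 0 3 (3 * n + 2) = N_d 1 3 (3 * n + 2) \<and> N_d 1 3 (3 * n + 2) = N_d 2 3 (3 * n + 2)"
proof -
  define N where "N = 3 * n + 2"
  define w where "w = Complex (- 1 / 2) (sqrt 3 / 2)"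
  define c where "c i = card {P. is_designated N P \<and> even_weight P mod 3 = i}" for i
  have c: "N_d 0 3 N = c 0" "N_d 1 3 N = c 1" "N_d 2 3 N = c 2"
    using pd_rank_cong[of _ 0] pd_rank_cong[of _ 1] pd_rank_cong[of _ 2]
    by (simp_all add: N_d_def c_def)
  have w2: "w\<^sup>2 = Complex (- 1 / 2) (- sqrt 3 / 2)"
    by (simp add: w_def power2_eq_square complex_eq_iff)
  have w: "w\<^sup>2 + w + 1 = 0"
    unfolding w2 by (simp add: w_def complex_eq_iff)
  have w3: "w ^ 3 = 1"
    using w by algebra
  \<comment> \<open>The bound \<open>2 * N\<close> is at least \<open>N\<close> and has the even
    form required by \<open>supp_mod3_rank_series\<close>.\<close>
  have "(\<Sum>P | is_designated N P. w ^ even_weight P) = rank_series w (2 * N) $ N"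
    by (rule rank_series_nth[symmetric]) simp
  also have "\<dots> = 0"
  proof -
    have "N mod 3 = 2" unfolding N_def by presburger
    then show ?thesis
      using supp_mod3_rank_series[OF w, of N, unfolded supp_mod3_def, rule_format, of N] by fastforce
  qed
  finally have "0 = (\<Sum>P | is_designated N P. w ^ even_weight P)" ..
  also have "\<dots> = (\<Sum>i\<in>{0, 1, 2}. \<Sum>P | P \<in> {P. is_designated N P} \<and> even_weight P mod 3 = i. w ^ even_weight P)"
    by (rule sum.group[symmetric]) (auto simp: finite_designated)
  also have "\<dots> = (\<Sum>i\<in>{0, 1, 2}. of_nat (c i) * w ^ i)"
  proof (intro sum.cong refl)
    fix i
    have "w ^ k = w ^ (k mod 3)" for k
      by (subst mult_div_mod_eq[of 3 k, symmetric], subst power_add) (simp add: power_mult w3)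
    then show "(\<Sum>P | P \<in> {P. is_designated N P} \<and> even_weight P mod 3 = i. w ^ even_weight P) = of_nat (c i) * w ^ i"
      by (subst sum.cong[OF refl, where h = "\<lambda>_. w ^ i"]) (auto simp: c_def)
  qed
  also have "\<dots> = of_nat (c 0) + of_nat (c 1) * w + of_nat (c 2) * w\<^sup>2"
    by simp
  \<comment> \<open>The imaginary part gives the first equation, the real part the second.\<close>
  finally have "real (c 1) = real (c 2)" "2 * real (c 0) = real (c 1) + real (c 2)"
    unfolding w2 by (simp_all add: w_def complex_eq_iff field_simps)
  then show ?thesis
    unfolding N_def[symmetric] c by simp
qed

end
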